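(* Let $\mathscr{N}_r^{(2,j)}=5^{\lfloor\frac{r-1}2\rfloor}\mathscr{F}_r^{(2,j)}$ for $j\in\{1,2\}$ and $r\ge1$ (the non-reduced numerator of $\mathscr{F}_r^{(2,j)}$). Then for $r=1,2,3,\dots$ $$\mathscr{N}_{2r-1}^{(2,1)}=\mathcal{L}_{2r-2},\qquad \mathscr{N}_{2r}^{(2,1)}=-\mathcal{F}_{2r-1},\qquad \mathscr{N}_{2r-1}^{(2,2)}=\mathcal{L}_{2r-1},\qquad \mathscr{N}_{2r}^{(2,2)}=-\mathcal{F}_{2r}.$$
   Context: $\mathcal{F}_n$ and $\mathcal{L}_n$ are the Fibonacci and Lucas numbers: $\mathcal{F}_1=\mathcal{F}_2=1$, $\mathcal{L}_0=2$, $\mathcal{L}_1=1$, both satisfying $u_{n+2}=u_{n+1}+u_n$. The rational sequences $\mathscr{F}_r^{(2,j)}$ are defined by $\mathscr{F}_1^{(2,1)}=2$, $\mathscr{F}_2^{(2,1)}=-1$, $\mathscr{F}_1^{(2,2)}=1$, $\mathscr{F}_2^{(2,2)}=-1$ and $\mathscr{F}_{r+2}^{(2,j)}=-\mathscr{F}_{r+1}^{(2,j)}-\frac15\mathscr{F}_r^{(2,j)}$ for $r\ge1$. *)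

theory Defs
  imports "HOL-Number_Theory.Fib"
begin

fun lucas_num :: "nat \<Rightarrow> nat" where
  "lucas_num 0 = 2"
| "lucas_num (Suc 0) = 1"
| "lucas_num (Suc (Suc n)) = lucas_num (Suc n) + lucas_num n"

text \<open>
  The sequences with superscript \<open>(2, j)\<close> are only meaningful for \<open>j = 1, 2\<close> and indices
  \<open>r \<ge> 1\<close>. The value at \<open>r = 0\<close> is a dummy which the recurrence never reads, and any \<open>j \<noteq> 1\<close>
  is treated like \<open>j = 2\<close>.
\<close>

fun scrF2 :: "nat \<Rightarrow> nat \<Rightarrow> rat" where
  "scrF2 j 0 = 0"
| "scrF2 j (Suc 0) = (if j = 1 then 2 else 1)"
| "scrF2 j (Suc (Suc 0)) = -1"
| "scrF2 j (Suc (Suc (Suc r))) = - scrF2 j (Suc (Suc r)) - (1/5) * scrF2 j (Suc r)"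

text \<open>
  The non-reduced numerator; for \<open>r \<ge> 1\<close> the exponent is the floor of \<open>(r - 1) / 2\<close>.
\<close>

definition scrN2 :: "nat \<Rightarrow> nat \<Rightarrow> rat" where
  "scrN2 j r = 5 ^ ((r - 1) div 2) * scrF2 j r"

end

theory Submission
  imports Defs
begin

text \<open>
  Clearing the denominator \<open>5\<close> from two consecutive steps of the recurrence
  \<open>u\<^sub>r\<^sub>+\<^sub>2 = - u\<^sub>r\<^sub>+\<^sub>1 - u\<^sub>r / 5\<close> gives a recurrence for the numerators that alternates with the
  parity of the index, because the power of \<open>5\<close> grows only at odd indices: a new odd-indexed
  numerator is \<open>- 5 b - a\<close> and a new even-indexed one is \<open>- b - a\<close>, where \<open>a, b\<close> are its two
  predecessors. On a pair \<open>(L\<^sub>m, - F\<^sub>m\<^sub>+\<^sub>1)\<close> of a Lucas number and a negated Fibonacci number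
  these two steps yield \<open>(L\<^sub>m\<^sub>+\<^sub>2, - F\<^sub>m\<^sub>+\<^sub>3)\<close>, by the classical identities
  \<open>5 F\<^sub>m\<^sub>+\<^sub>1 = L\<^sub>m + L\<^sub>m\<^sub>+\<^sub>2\<close> and \<open>L\<^sub>m\<^sub>+\<^sub>2 = F\<^sub>m\<^sub>+\<^sub>1 + F\<^sub>m\<^sub>+\<^sub>3\<close>. The two families differ only in where they
  start: at \<open>m = 0\<close> with \<open>(2, -1)\<close> for \<open>j = 1\<close>, and at \<open>m = 1\<close> with \<open>(1, -1)\<close> for \<open>j = 2\<close>.
\<close>

lemma lucas_num_Suc_eq_fib_sum: "lucas_num (Suc m) = fib m + fib (Suc (Suc m))"
  by (induction m rule: fib.induct) simp_all

lemma five_fib_eq_lucas_sum: "5 * fib (Suc m) = lucas_num m + lucas_num (Suc (Suc m))"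
  by (induction m rule: fib.induct) simp_all

lemma scrN2_odd_step:
  "scrN2 j (2 * k + 3) = - 5 * scrN2 j (2 * k + 2) - scrN2 j (2 * k + 1)"
  by (simp add: scrN2_def numeral_3_eq_3 algebra_simps)

lemma scrN2_even_step:
  "scrN2 j (2 * k + 4) = - scrN2 j (2 * k + 3) - scrN2 j (2 * k + 2)"
proof -
  have "2 * k + 4 = Suc (Suc (Suc (2 * k + 1)))" by simp
  then have "scrF2 j (2 * k + 4) = - scrF2 j (2 * k + 3) - (1/5) * scrF2 j (2 * k + 2)"
    by (simp only: scrF2.simps) (simp add: numeral_eq_Suc)
  moreover have "(2 * k + 4 - 1) div 2 = k + 1" "(2 * k + 3 - 1) div 2 = k + 1"
      "(2 * k + 2 - 1) div 2 = k"
    by simp_all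
  ultimately show ?thesis
    by (simp only: scrN2_def power_add) (simp add: right_diff_distrib)
qed

text \<open>
  The odd and the even entry must be carried through the induction together, since each step
  of the alternating recurrence mixes them.
\<close>

lemma scrN2_eq_lucas_fib_from_start:
  assumes "scrN2 j 1 = of_nat (lucas_num m)" and "scrN2 j 2 = - of_nat (fib (Suc m))"
  shows "scrN2 j (2 * k + 1) = of_nat (lucas_num (2 * k + m))
    \<and> scrN2 j (2 * k + 2) = - of_nat (fib (Suc (2 * k + m)))"
proof (induction k)
  case 0
  then show ?case using assms by (simp add: numeral_2_eq_2)
next
  case (Suc k)
  let ?n = "2 * k + m"
  have "(of_nat (5 * fib (Suc ?n)) :: rat) = of_nat (lucas_num ?n + lucas_num (Suc (Suc ?n)))"
    by (simp only: five_fib_eq_lucas_sum)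
  then have odd: "scrN2 j (2 * k + 3) = of_nat (lucas_num (Suc (Suc ?n)))"
    using Suc.IH by (simp only: scrN2_odd_step of_nat_add of_nat_mult of_nat_numeral)
  have "(of_nat (lucas_num (Suc (Suc ?n))) :: rat)
      = of_nat (fib (Suc ?n) + fib (Suc (Suc (Suc ?n))))"
    by (simp only: lucas_num_Suc_eq_fib_sum)
  then have even: "scrN2 j (2 * k + 4) = - of_nat (fib (Suc (Suc (Suc ?n))))"
    using Suc.IH odd by (simp only: scrN2_even_step of_nat_add)
  have "2 * Suc k + 1 = 2 * k + 3" "2 * Suc k + 2 = 2 * k + 4" "2 * Suc k + m = Suc (Suc ?n)"
    by simp_all
  then show ?case using odd even by (simp only:)
qed

theorem lemma2p3:
  fixes r :: nat
  assumes "r \<ge> 1"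
  shows "scrN2 1 (2 * r - 1) = of_nat (lucas_num (2 * r - 2))
    \<and> scrN2 1 (2 * r) = - of_nat (fib (2 * r - 1))
    \<and> scrN2 2 (2 * r - 1) = of_nat (lucas_num (2 * r - 1))
    \<and> scrN2 2 (2 * r) = - of_nat (fib (2 * r))"
proof -
  obtain k where r: "r = Suc k"
    using assms by (cases r) auto
  have "scrN2 1 1 = of_nat (lucas_num 0)" "scrN2 1 2 = - of_nat (fib (Suc 0))"
    by (simp_all add: scrN2_def numeral_2_eq_2)
  note first = scrN2_eq_lucas_fib_from_start [OF this, of k]
  have "scrN2 2 1 = of_nat (lucas_num 1)" "scrN2 2 2 = - of_nat (fib (Suc 1))"
    by (simp_all add: scrN2_def numeral_2_eq_2)
  note second = scrN2_eq_lucas_fib_from_start [OF this, of k]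
  have "2 * r - 1 = 2 * k + 1" "2 * r = 2 * k + 2" "2 * r - 2 = 2 * k"
    by (simp_all add: r)
  then show ?thesis
    using first second by simp
qed

end
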